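(* Let $N\ge2$ and $T\ge1$ be integers, let $l_{i,t}\in[0,1]$, $1\le i\le N$, $1\le t\le T$, be losses and $S_1,\ldots,S_T\subseteq\{1,\ldots,N\}$ be subsets, all fixed in advance (oblivious adversary). Suppose that on every round $t$ the learner receives, in addition to the loss of its chosen expert, the losses of all experts in $S_t$; this is modelled by the lower bounds $\lambda_{i,t}=l_{i,t}$ for $i\in S_t$ and $\lambda_{i,t}=0$ for $i\notin S_t$. Then for $$\eta = \sqrt{\frac{8\log N}{9T + 4\sum_{t=1}^T(N-|S_t|)}}$$ the algorithm Exp3.LB with parameter $\eta$ and these lower bounds satisfies $$\mathbb{E}\, R_{Exp3.LB,T} \leq \sqrt{\Big(\frac{9T}{2} + 2\sum_{t=1}^T(N-|S_t|)\Big)\log N}.$$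
   Context: $\log$ is the natural logarithm. There are $N$ experts and $T$ rounds; on each round $t$ the learner draws an expert $I_t$ from a distribution $\mathbf{p}_t$ on $\{1,\ldots,N\}$ (conditionally on the past) and incurs loss $l_{I_t,t}$. Exp3.LB with parameter $\eta>0$ and lower bounds $\lambda_{i,t}\le l_{i,t}$: let $s_{i,t}=l_{i,t}-\lambda_{i,t}$; $\mathbf{p}_1$ is uniform and $\widetilde{L}_{i,0}=0$ for all $i$. On each round $t=1,\ldots,T$: draw $I_t\sim\mathbf{p}_t$; set $\widetilde{l}_{i,t} = \frac{s_{i,t}}{p_{i,t}}\mathbb{I}\{I_t=i\}+\lambda_{i,t}$ and $\widetilde{L}_{i,t}=\widetilde{L}_{i,t-1}+\widetilde{l}_{i,t}$ for every $i$; set $p_{i,t+1}=\exp(-\eta \widetilde{L}_{i,t})/\sum_{k=1}^N\exp(-\eta\widetilde{L}_{k,t})$. The regret is $R_{Exp3.LB,T}=\sum_{t=1}^T l_{I_t,t}-\min_j\sum_{t=1}^T l_{j,t}$. *)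

theory Defs
  imports "HOL-Probability.Probability"
begin

text \<open>
  Experts are the numbers \<open>1..N\<close>, rounds are \<open>1, 2, \<dots>\<close>. Throughout, \<open>l i t\<close> is the loss of expert
  \<open>i\<close> in round \<open>t\<close>, \<open>lb i t\<close> is the lower bound on it, and \<open>I t\<close> is the expert drawn in round \<open>t\<close>.
  Values of these functions outside the ranges of experts and rounds are irrelevant.
\<close>

definition exp_weights :: "nat \<Rightarrow> real \<Rightarrow> (nat \<Rightarrow> real) \<Rightarrow> nat \<Rightarrow> real" where
  "exp_weights N \<eta> L i = exp (- \<eta> * L i) / (\<Sum>k=1..N. exp (- \<eta> * L k))"

text \<open>
  The cumulative estimates after round \<open>t\<close>, as a function of the draws \<open>I 1, \<dots>, I t\<close>. The sampling
  distribution of round \<open>Suc t\<close> is the one with weights computed from the estimates after round \<open>t\<close>;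
  for \<open>t = 0\<close> it is uniform (lemma \<open>exp3lb_prob_first\<close> below).
\<close>

primrec exp3lb_cum_est ::
  "nat \<Rightarrow> real \<Rightarrow> (nat \<Rightarrow> nat \<Rightarrow> real) \<Rightarrow> (nat \<Rightarrow> nat \<Rightarrow> real) \<Rightarrow> (nat \<Rightarrow> nat) \<Rightarrow> nat \<Rightarrow> nat \<Rightarrow> real"
where
  "exp3lb_cum_est N \<eta> l lb I 0 = (\<lambda>i. 0)"
| "exp3lb_cum_est N \<eta> l lb I (Suc t) = (\<lambda>i.
     exp3lb_cum_est N \<eta> l lb I t i
     + ((l i (Suc t) - lb i (Suc t)) / exp_weights N \<eta> (exp3lb_cum_est N \<eta> l lb I t) i
          * of_bool (I (Suc t) = i)
        + lb i (Suc t)))"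

definition exp3lb_prob ::
  "nat \<Rightarrow> real \<Rightarrow> (nat \<Rightarrow> nat \<Rightarrow> real) \<Rightarrow> (nat \<Rightarrow> nat \<Rightarrow> real) \<Rightarrow> (nat \<Rightarrow> nat) \<Rightarrow> nat \<Rightarrow> nat \<Rightarrow> real"
where
  "exp3lb_prob N \<eta> l lb I t = exp_weights N \<eta> (exp3lb_cum_est N \<eta> l lb I (t - 1))"

definition exp3lb_draw ::
  "nat \<Rightarrow> real \<Rightarrow> (nat \<Rightarrow> nat \<Rightarrow> real) \<Rightarrow> (nat \<Rightarrow> nat \<Rightarrow> real) \<Rightarrow> (nat \<Rightarrow> nat) \<Rightarrow> nat \<Rightarrow> nat pmf"
where
  "exp3lb_draw N \<eta> l lb I t =
     embed_pmf (\<lambda>i. if i \<in> {1..N} then exp3lb_prob N \<eta> l lb I t i else 0)"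

text \<open>
  The joint law of the draws of the first \<open>t\<close> rounds: conditionally on \<open>I 1, \<dots>, I t\<close>, the draw
  \<open>I (Suc t)\<close> has law \<open>exp3lb_draw N \<eta> l lb I (Suc t)\<close>. Rounds not yet played carry the dummy value \<open>0\<close>,
  which is not an expert.
\<close>

primrec exp3lb ::
  "nat \<Rightarrow> real \<Rightarrow> (nat \<Rightarrow> nat \<Rightarrow> real) \<Rightarrow> (nat \<Rightarrow> nat \<Rightarrow> real) \<Rightarrow> nat \<Rightarrow> (nat \<Rightarrow> nat) pmf"
where
  "exp3lb N \<eta> l lb 0 = return_pmf (\<lambda>_. 0)"
| "exp3lb N \<eta> l lb (Suc t) =
     bind_pmf (exp3lb N \<eta> l lb t) (\<lambda>I.
       map_pmf (\<lambda>i. I(Suc t := i)) (exp3lb_draw N \<eta> l lb I (Suc t)))"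

definition regret :: "nat \<Rightarrow> (nat \<Rightarrow> nat \<Rightarrow> real) \<Rightarrow> (nat \<Rightarrow> nat) \<Rightarrow> nat \<Rightarrow> real" where
  "regret N l I T = (\<Sum>t=1..T. l (I t) t) - (MIN j\<in>{1..N}. \<Sum>t=1..T. l j t)"

definition observed_lb ::
  "(nat \<Rightarrow> nat set) \<Rightarrow> (nat \<Rightarrow> nat \<Rightarrow> real) \<Rightarrow> nat \<Rightarrow> nat \<Rightarrow> real" where
  "observed_lb S l i t = (if i \<in> S t then l i t else 0)"

lemma exp_weights_pos: "i \<in> {1..N} \<Longrightarrow> exp_weights N \<eta> L i > 0"
  unfolding exp_weights_def by (intro divide_pos_pos sum_pos) auto

lemma sum_exp_weights:
  assumes "N \<ge> 1"
  shows "(\<Sum>i=1..N. exp_weights N \<eta> L i) = 1"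
proof -
  have "(\<Sum>k=1..N. exp (- \<eta> * L k)) > 0"
    using assms by (intro sum_pos) auto
  then show ?thesis
    by (simp add: exp_weights_def flip: sum_divide_distrib)
qed

lemma exp3lb_prob_first: "exp3lb_prob N \<eta> l lb I 1 i = 1 / real N"
  by (simp add: exp3lb_prob_def exp_weights_def)

lemma pmf_exp3lb_draw:
  assumes "N \<ge> 1"
  shows "pmf (exp3lb_draw N \<eta> l lb I t) i =
           (if i \<in> {1..N} then exp3lb_prob N \<eta> l lb I t i else 0)"
proof -
  let ?p = "exp3lb_prob N \<eta> l lb I t"
  have nonneg: "?p j \<ge> 0" if "j \<in> {1..N}" for j
    using exp_weights_pos[OF that] by (simp add: exp3lb_prob_def less_imp_le)
  have "(\<integral>\<^sup>+ j. ennreal (if j \<in> {1..N} then ?p j else 0) \<partial>count_space UNIV) =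
        (\<Sum>j=1..N. ennreal (?p j))"
    by (subst nn_integral_count_space'[of "{1..N}"]) auto
  also have "\<dots> = ennreal (\<Sum>j=1..N. ?p j)"
    using nonneg by (intro sum_ennreal) auto
  also have "\<dots> = 1"
    using sum_exp_weights[OF assms] by (simp add: exp3lb_prob_def)
  finally show ?thesis
    unfolding exp3lb_draw_def using nonneg by (intro pmf_embed_pmf) auto
qed

end

theory Submission
  imports Defs
begin

text \<open>
  The logarithm of \<open>W t = (\<Sum>i=1..N. exp (- \<eta> * L i t))\<close>, with \<open>L\<close> the cumulative estimates, serves as
  potential. As the loss estimates are nonnegative, \<open>exp (- x) \<le> 1 - x + x\<^sup>2 / 2\<close> bounds its increment
  in a round by \<open>- \<eta>\<close> times the mean plus \<open>\<eta>\<^sup>2 / 2\<close> times the second moment of the estimates under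
  the sampling distribution \<open>p\<close>. The estimate of expert \<open>i\<close> has conditional mean \<open>l i\<close> and, with
  \<open>s = l - \<lambda>\<close>, conditional second moment \<open>(s i)\<^sup>2 / p i + 2 * s i * \<lambda> i + (\<lambda> i)\<^sup>2\<close>; weighting by \<open>p i\<close>
  and summing over \<open>i\<close> gives at most \<open>1 + (\<Sum>i=1..N. (s i)\<^sup>2)\<close>, which for observed losses is at most
  \<open>1 + N - |S|\<close>. Telescoping and comparing \<open>W T\<close> with the term of the best expert bounds the expected
  regret by \<open>ln N / \<eta> + \<eta> / 2 * (T + M)\<close> for \<open>M\<close> the sum of \<open>N - |S|\<close> over the rounds. The given \<open>\<eta>\<close>
  balances \<open>ln N / \<eta>\<close> against the larger quantity \<open>\<eta> / 8 * (9 * T + 4 * M)\<close>.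
\<close>

section \<open>Second-order bounds for the exponential\<close>

text \<open>The difference of the two sides vanishes at 0, and its derivative
  \<open>y - 1 + exp (- y)\<close> is nonnegative by the tangent bound for \<open>exp\<close> at
  0.\<close>

lemma exp_minus_le_quadratic:
  fixes x :: real
  assumes "x \<ge> 0"
  shows "exp (- x) \<le> 1 - x + x\<^sup>2 / 2"
proof -
  let ?f = "\<lambda>x::real. 1 - x + x\<^sup>2 / 2 - exp (- x)"
  have "?f 0 \<le> ?f x"
  proof (rule DERIV_nonneg_imp_nondecreasing[OF assms])
    fix y :: real
    have "(?f has_real_derivative (y - 1 + exp (- y))) (at y)"
      by (auto intro!: derivative_eq_intros)
    moreover have "y - 1 + exp (- y) \<ge> 0"
      using exp_ge_add_one_self[of "- y"] by simp
    ultimately show "\<exists>d. (?f has_real_derivative d) (at y) \<and> d \<ge> 0"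
      by blast
  qed
  then show ?thesis by simp
qed

text \<open>The quadratic bound is averaged under the probability weights \<open>p\<close>, and
  \<open>ln z \<le> z - 1\<close> absorbs the leading 1.\<close>

lemma ln_sum_exp_minus_le:
  fixes p x :: "'a \<Rightarrow> real"
  assumes A: "finite A" "\<And>i. i \<in> A \<Longrightarrow> p i > 0" "sum p A = 1"
    and x: "\<And>i. i \<in> A \<Longrightarrow> x i \<ge> 0"
    and "\<eta> \<ge> 0"
  shows "ln (\<Sum>i\<in>A. p i * exp (- \<eta> * x i))
           \<le> - \<eta> * (\<Sum>i\<in>A. p i * x i) + \<eta>\<^sup>2 / 2 * (\<Sum>i\<in>A. p i * (x i)\<^sup>2)"
proof -
  have "A \<noteq> {}" using A(3) by auto
  then have pos: "(\<Sum>i\<in>A. p i * exp (- \<eta> * x i)) > 0"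
    using A by (intro sum_pos) auto
  have "(\<Sum>i\<in>A. p i * exp (- \<eta> * x i)) \<le> (\<Sum>i\<in>A. p i * (1 - \<eta> * x i + (\<eta> * x i)\<^sup>2 / 2))"
    using assms exp_minus_le_quadratic[of "\<eta> * x _"]
    by (intro sum_mono mult_left_mono) (auto simp: less_imp_le)
  also have "\<dots> = 1 - \<eta> * (\<Sum>i\<in>A. p i * x i) + \<eta>\<^sup>2 / 2 * (\<Sum>i\<in>A. p i * (x i)\<^sup>2)"
    by (simp add: A(3) sum_distrib_left right_diff_distrib distrib_left sum.distrib sum_subtractf
        power_mult_distrib mult_ac)
  finally show ?thesis
    using ln_le_minus_one[OF pos] by linarith
qed

section \<open>Expectations over the draws and unbiasedness of the estimates\<close>

lemma finite_set_pmf_exp3lb_draw: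
  "N \<ge> 1 \<Longrightarrow> finite (set_pmf (exp3lb_draw N \<eta> l lb I t))"
  by (rule finite_subset[of _ "{1..N}"]) (auto simp: set_pmf_eq pmf_exp3lb_draw)

lemma finite_set_pmf_exp3lb: "N \<ge> 1 \<Longrightarrow> finite (set_pmf (exp3lb N \<eta> l lb t))"
  by (induction t) (auto simp: finite_set_pmf_exp3lb_draw)

lemma integrable_exp3lb:
  fixes f :: "(nat \<Rightarrow> nat) \<Rightarrow> real"
  shows "N \<ge> 1 \<Longrightarrow> integrable (measure_pmf (exp3lb N \<eta> l lb t)) f"
  by (intro integrable_measure_pmf_finite finite_set_pmf_exp3lb)

text \<open>Tower property: with the history \<open>I\<close> fixed, averaging over the last draw is
  a finite weighted sum, so each claim about expectations reduces to a one-round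
  computation.\<close>

lemma expectation_exp3lb_Suc:
  fixes f :: "(nat \<Rightarrow> nat) \<Rightarrow> real"
  assumes "N \<ge> 1"
  shows "measure_pmf.expectation (exp3lb N \<eta> l lb (Suc t)) f =
    measure_pmf.expectation (exp3lb N \<eta> l lb t)
      (\<lambda>I. \<Sum>a=1..N. exp3lb_prob N \<eta> l lb I (Suc t) a * f (I(Suc t := a)))"
proof -
  have "measure_pmf.expectation (exp3lb_draw N \<eta> l lb I (Suc t)) g =
      (\<Sum>a=1..N. exp3lb_prob N \<eta> l lb I (Suc t) a * g a)" for I and g :: "nat \<Rightarrow> real"
    using assms
    by (subst integral_measure_pmf[of "{1..N}"])
      (auto simp: set_pmf_eq pmf_exp3lb_draw intro!: sum.cong split: if_splits)
  then show ?thesis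
    using assms
    by (simp, subst pmf_expectation_bind[where A = "set_pmf (exp3lb N \<eta> l lb t)"])
      (auto simp: finite_set_pmf_exp3lb finite_set_pmf_exp3lb_draw
        integral_measure_pmf[of "set_pmf (exp3lb N \<eta> l lb t)"])
qed

text \<open>The estimates after round \<open>t\<close> read only the draws of rounds up to
  \<open>t\<close>.\<close>

lemma exp3lb_cum_est_upd:
  "t < r \<Longrightarrow> exp3lb_cum_est N \<eta> l lb (I(r := a)) t = exp3lb_cum_est N \<eta> l lb I t"
  by (induction t) auto

text \<open>First and second moments of a loss estimate, with \<open>s\<close> the gap and
  \<open>m\<close> the lower bound: the event \<open>a = i\<close> has probability
  \<open>p i\<close>, which cancels one factor \<open>1 / p i\<close>.\<close>

lemma expectation_importance_weight:
  fixes p :: "nat \<Rightarrow> real"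
  assumes "i \<in> {1..N}" "p i \<noteq> 0" "sum p {1..N} = 1"
  shows "(\<Sum>a=1..N. p a * (s / p i * of_bool (a = i) + m)) = s + m"
    and "(\<Sum>a=1..N. p a * (s / p i * of_bool (a = i) + m)\<^sup>2) = s\<^sup>2 / p i + 2 * s * m + m\<^sup>2"
proof -
  have ind: "(\<Sum>a=1..N. p a * (c * of_bool (a = i) + m')) = p i * c + m'" for c m'
    using assms
    by (simp add: distrib_left sum.distrib flip: sum_distrib_right)
       (subst sum.remove[of _ i]; auto)
  show "(\<Sum>a=1..N. p a * (s / p i * of_bool (a = i) + m)) = s + m"
    using ind[of "s / p i" m] assms by simp
  \<comment> \<open>An indicator equals its square, so the squared estimate is again affine in the
    indicator and \<open>ind\<close> applies to it.\<close>
  have "(s / p i * of_bool (a = i) + m)\<^sup>2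
      = ((s / p i)\<^sup>2 + 2 * s / p i * m) * of_bool (a = i) + m\<^sup>2" for a
    by (auto simp: power2_eq_square algebra_simps)
  then have "(\<Sum>a=1..N. p a * (s / p i * of_bool (a = i) + m)\<^sup>2)
      = p i * ((s / p i)\<^sup>2 + 2 * s / p i * m) + m\<^sup>2"
    by (simp only: ind)
  also have "\<dots> = s\<^sup>2 / p i + 2 * s * m + m\<^sup>2"
    using assms(2) by (simp add: power2_eq_square field_simps)
  finally show "(\<Sum>a=1..N. p a * (s / p i * of_bool (a = i) + m)\<^sup>2) = s\<^sup>2 / p i + 2 * s * m + m\<^sup>2" .
qed

lemma exp3lb_prob_pos: "i \<in> {1..N} \<Longrightarrow> exp3lb_prob N \<eta> l lb I t i > 0"
  by (simp add: exp3lb_prob_def exp_weights_pos)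

lemma sum_exp3lb_prob: "N \<ge> 1 \<Longrightarrow> (\<Sum>i=1..N. exp3lb_prob N \<eta> l lb I t i) = 1"
  unfolding exp3lb_prob_def by (rule sum_exp_weights)

lemma exp3lb_cum_est_step:
  "exp3lb_cum_est N \<eta> l lb (I(Suc t := a)) (Suc t) i = exp3lb_cum_est N \<eta> l lb I t i +
     ((l i (Suc t) - lb i (Suc t)) / exp3lb_prob N \<eta> l lb I (Suc t) i * of_bool (a = i)
      + lb i (Suc t))"
  by (simp add: exp3lb_cum_est_upd exp3lb_prob_def)

text \<open>Given the history, the increment of a round has mean \<open>s + m\<close>, which is the
  true loss because \<open>lb\<close> cancels.\<close>

lemma expectation_exp3lb_cum_est:
  assumes "i \<in> {1..N}"
  shows "measure_pmf.expectation (exp3lb N \<eta> l lb t) (\<lambda>I. exp3lb_cum_est N \<eta> l lb I t i)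
           = (\<Sum>r=1..t. l i r)"
proof (induction t)
  case (Suc t)
  have N: "N \<ge> 1" using assms by simp
  have "(\<Sum>a=1..N. exp3lb_prob N \<eta> l lb I (Suc t) a *
      exp3lb_cum_est N \<eta> l lb (I(Suc t := a)) (Suc t) i)
      = exp3lb_cum_est N \<eta> l lb I t i + l i (Suc t)" for I
    unfolding exp3lb_cum_est_step
    using expectation_importance_weight(1)[OF assms, of "exp3lb_prob N \<eta> l lb I (Suc t)"]
      exp3lb_prob_pos[OF assms] sum_exp3lb_prob[OF N]
    by (simp add: distrib_left[of _ "exp3lb_cum_est _ _ _ _ _ _ _"] sum.distrib
        less_imp_neq[symmetric] flip: sum_distrib_right)
  then show ?case
    using N Suc.IH by (simp add: expectation_exp3lb_Suc integrable_exp3lb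
        del: exp3lb.simps exp3lb_cum_est.simps)
qed simp

section \<open>Drift of the logarithmic potential\<close>

definition exp3lb_log_potential ::
  "nat \<Rightarrow> real \<Rightarrow> (nat \<Rightarrow> nat \<Rightarrow> real) \<Rightarrow> (nat \<Rightarrow> nat \<Rightarrow> real) \<Rightarrow> (nat \<Rightarrow> nat) \<Rightarrow> nat \<Rightarrow> real"
where
  "exp3lb_log_potential N \<eta> l lb I t = ln (\<Sum>i=1..N. exp (- \<eta> * exp3lb_cum_est N \<eta> l lb I t i))"

lemma exp3lb_log_potential_step:
  fixes I :: "nat \<Rightarrow> nat"
  assumes N: "N \<ge> 1" and "\<eta> \<ge> 0"
    and bounds: "\<And>i. i \<in> {1..N} \<Longrightarrow>
      0 \<le> lb i (Suc t) \<and> lb i (Suc t) \<le> l i (Suc t) \<and> l i (Suc t) \<le> 1"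
  defines "p \<equiv> exp3lb_prob N \<eta> l lb I (Suc t)"
  shows "(\<Sum>a=1..N. p a * exp3lb_log_potential N \<eta> l lb (I(Suc t := a)) (Suc t))
     \<le> exp3lb_log_potential N \<eta> l lb I t - \<eta> * (\<Sum>a=1..N. p a * l a (Suc t))
        + \<eta>\<^sup>2 / 2 * (1 + (\<Sum>i=1..N. (l i (Suc t) - lb i (Suc t))\<^sup>2))"
proof -
  define s m where "s i = l i (Suc t) - lb i (Suc t)" and "m i = lb i (Suc t)" for i
  define x where "x a i = s i / p i * of_bool (a = i) + m i" for a i
  define W where "W = (\<Sum>i=1..N. exp (- \<eta> * exp3lb_cum_est N \<eta> l lb I t i))"
  let ?P = "exp3lb_log_potential N \<eta> l lb I t"
  have p: "p i > 0" if "i \<in> {1..N}" for i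
    using exp3lb_prob_pos[OF that] by (simp add: p_def)
  have sum_p: "sum p {1..N} = 1"
    using sum_exp3lb_prob[OF N] by (simp add: p_def)
  have W: "W > 0" unfolding W_def using N by (intro sum_pos) auto
  \<comment> \<open>The sampling probabilities are the normalised weights. A round therefore
    multiplies the weight sum \<open>W\<close> by the \<open>p\<close>-average of
    \<open>exp (- \<eta> * x a i)\<close>, and the log potential grows by the logarithm of that
    average.\<close>
  have pW: "exp (- \<eta> * exp3lb_cum_est N \<eta> l lb I t i) = W * p i" for i
    using W by (simp add: p_def exp3lb_prob_def exp_weights_def W_def)
  have sm: "0 \<le> s i" "0 \<le> m i" "s i + m i \<le> 1" if "i \<in> {1..N}" for i
    using bounds[OF that] by (auto simp: s_def m_def)
  have step: "exp3lb_log_potential N \<eta> l lb (I(Suc t := a)) (Suc t)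
      \<le> ?P + (- \<eta> * (\<Sum>i=1..N. p i * x a i) + \<eta>\<^sup>2 / 2 * (\<Sum>i=1..N. p i * (x a i)\<^sup>2))"
    for a
  proof -
    have "exp (- \<eta> * exp3lb_cum_est N \<eta> l lb (I(Suc t := a)) (Suc t) i)
        = W * (p i * exp (- \<eta> * x a i))" for i
      unfolding exp3lb_cum_est_step distrib_left[of "- \<eta>" "exp3lb_cum_est N \<eta> l lb I t i"] exp_add pW
      by (simp add: x_def s_def m_def p_def)
    moreover have "(\<Sum>i=1..N. p i * exp (- \<eta> * x a i)) > 0"
      using N p by (intro sum_pos) auto
    ultimately have "exp3lb_log_potential N \<eta> l lb (I(Suc t := a)) (Suc t)
        = ?P + ln (\<Sum>i=1..N. p i * exp (- \<eta> * x a i))"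
      using W unfolding exp3lb_log_potential_def W_def[symmetric]
      by (simp add: ln_mult del: exp3lb_cum_est.simps flip: sum_distrib_left)
    also have "ln (\<Sum>i=1..N. p i * exp (- \<eta> * x a i))
        \<le> - \<eta> * (\<Sum>i=1..N. p i * x a i) + \<eta>\<^sup>2 / 2 * (\<Sum>i=1..N. p i * (x a i)\<^sup>2)"
      using p sum_p sm \<open>\<eta> \<ge> 0\<close>
      by (intro ln_sum_exp_minus_le) (auto simp: x_def less_imp_le)
    finally show ?thesis by simp
  qed
  \<comment> \<open>Exchanging the sums puts the average over the drawn expert \<open>a\<close>
    inside, where unbiasedness applies for each \<open>i\<close>.\<close>
  have first: "(\<Sum>a=1..N. p a * (\<Sum>i=1..N. p i * x a i)) = (\<Sum>i=1..N. p i * l i (Suc t))"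
  proof -
    have "(\<Sum>a=1..N. p a * (\<Sum>i=1..N. p i * x a i)) = (\<Sum>i=1..N. p i * (\<Sum>a=1..N. p a * x a i))"
      unfolding sum_distrib_left by (subst sum.swap) (simp add: mult_ac)
    also have "\<dots> = (\<Sum>i=1..N. p i * l i (Suc t))"
    proof (intro sum.cong refl)
      fix i assume i: "i \<in> {1..N}"
      show "p i * (\<Sum>a=1..N. p a * x a i) = p i * l i (Suc t)"
        using expectation_importance_weight(1)[OF i _ sum_p, of "s i" "m i"] p[OF i]
        by (simp add: x_def s_def m_def)
    qed
    finally show ?thesis .
  qed
  have second: "(\<Sum>a=1..N. p a * (\<Sum>i=1..N. p i * (x a i)\<^sup>2)) \<le> 1 + (\<Sum>i=1..N. (s i)\<^sup>2)"
  proof -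
    have "(\<Sum>a=1..N. p a * (\<Sum>i=1..N. p i * (x a i)\<^sup>2))
        = (\<Sum>i=1..N. p i * (\<Sum>a=1..N. p a * (x a i)\<^sup>2))"
      unfolding sum_distrib_left by (subst sum.swap) (simp add: mult_ac)
    \<comment> \<open>The outer \<open>p i\<close> cancels the denominator in
      \<open>(s i)\<^sup>2 / p i\<close>; the remaining moment terms are at most
      \<open>(s i + m i)\<^sup>2 \<le> 1\<close>, so they contribute at most
      \<open>p i\<close>.\<close>
    also have "\<dots> \<le> (\<Sum>i=1..N. p i + (s i)\<^sup>2)"
    proof (intro sum_mono)
      fix i assume i: "i \<in> {1..N}"
      have "2 * s i * m i + (m i)\<^sup>2 \<le> (s i + m i)\<^sup>2"
        by (simp add: power2_eq_square algebra_simps)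
      also have "\<dots> \<le> 1"
        using sm[OF i] by (simp add: power_le_one)
      finally have "p i * (2 * s i * m i + (m i)\<^sup>2) \<le> p i"
        using p[OF i] by (simp add: mult_left_le)
      then show "p i * (\<Sum>a=1..N. p a * (x a i)\<^sup>2) \<le> p i + (s i)\<^sup>2"
        using expectation_importance_weight(2)[OF i _ sum_p, of "s i" "m i"] p[OF i]
        by (simp add: x_def distrib_left)
    qed
    also have "\<dots> = 1 + (\<Sum>i=1..N. (s i)\<^sup>2)"
      using sum_p by (simp add: sum.distrib)
    finally show ?thesis .
  qed
  \<comment> \<open>Stated for arbitrary \<open>u\<close> and \<open>v\<close> so that the inner
    sums over \<open>i\<close> stay intact when the outer sum is distributed.\<close>
  have linear: "(\<Sum>a=1..N. p a * (w + (- \<eta> * u a + c * v a)))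
      = (\<Sum>a=1..N. p a * w) - \<eta> * (\<Sum>a=1..N. p a * u a) + c * (\<Sum>a=1..N. p a * v a)"
    for w c u v
    by (simp add: sum_distrib_left distrib_left right_diff_distrib sum.distrib sum_subtractf
        mult.left_commute)
  have "(\<Sum>a=1..N. p a * exp3lb_log_potential N \<eta> l lb (I(Suc t := a)) (Suc t))
      \<le> (\<Sum>a=1..N. p a * (?P
          + (- \<eta> * (\<Sum>i=1..N. p i * x a i) + \<eta>\<^sup>2 / 2 * (\<Sum>i=1..N. p i * (x a i)\<^sup>2))))"
    using step p by (intro sum_mono mult_left_mono) (auto simp: less_imp_le)
  also have "\<dots> = (\<Sum>a=1..N. p a * ?P) - \<eta> * (\<Sum>a=1..N. p a * (\<Sum>i=1..N. p i * x a i))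
      + \<eta>\<^sup>2 / 2 * (\<Sum>a=1..N. p a * (\<Sum>i=1..N. p i * (x a i)\<^sup>2))"
    by (rule linear)
  also have "(\<Sum>a=1..N. p a * ?P) = ?P"
    using sum_p by (simp flip: sum_distrib_right)
  also have "\<eta>\<^sup>2 / 2 * (\<Sum>a=1..N. p a * (\<Sum>i=1..N. p i * (x a i)\<^sup>2))
      \<le> \<eta>\<^sup>2 / 2 * (1 + (\<Sum>i=1..N. (s i)\<^sup>2))"
    using second by (intro mult_left_mono) auto
  finally show ?thesis
    unfolding first s_def by (simp del: fun_upd_apply)
qed

text \<open>Adding \<open>\<eta>\<close> times the realised loss cancels, in conditional mean, the
  negative drift of the potential, so each round adds only its second-moment term. The initial value
  is \<open>ln N\<close>, since all estimates start at 0.\<close>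

lemma expectation_exp3lb_log_potential:
  assumes N: "N \<ge> 1" and "\<eta> \<ge> 0"
    and bounds: "\<And>i r. i \<in> {1..N} \<Longrightarrow> r \<in> {1..t} \<Longrightarrow> 0 \<le> lb i r \<and> lb i r \<le> l i r \<and> l i r \<le> 1"
  shows "measure_pmf.expectation (exp3lb N \<eta> l lb t)
      (\<lambda>I. exp3lb_log_potential N \<eta> l lb I t + \<eta> * (\<Sum>r=1..t. l (I r) r))
    \<le> ln (real N) + \<eta>\<^sup>2 / 2 * (\<Sum>r=1..t. 1 + (\<Sum>i=1..N. (l i r - lb i r)\<^sup>2))"
  using bounds
proof (induction t)
  case 0
  then show ?case by (simp add: exp3lb_log_potential_def)
next
  case (Suc t)
  let ?E = "\<lambda>t. measure_pmf.expectation (exp3lb N \<eta> l lb t)"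
  let ?P = "exp3lb_log_potential N \<eta> l lb"
  let ?C = "\<lambda>r. \<eta>\<^sup>2 / 2 * (1 + (\<Sum>i=1..N. (l i r - lb i r)\<^sup>2))"
  have "(\<Sum>a=1..N. exp3lb_prob N \<eta> l lb I (Suc t) a *
      (?P (I(Suc t := a)) (Suc t) + \<eta> * (\<Sum>r=1..Suc t. l ((I(Suc t := a)) r) r)))
      \<le> ?P I t + \<eta> * (\<Sum>r=1..t. l (I r) r) + ?C (Suc t)" for I
  proof -
    let ?p = "exp3lb_prob N \<eta> l lb I (Suc t)"
    have "(\<Sum>r=1..Suc t. l ((I(Suc t := a)) r) r) = (\<Sum>r=1..t. l (I r) r) + l a (Suc t)" for a
      by (auto intro!: sum.cong)
    then have "(\<Sum>a=1..N. ?p a *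
        (?P (I(Suc t := a)) (Suc t) + \<eta> * (\<Sum>r=1..Suc t. l ((I(Suc t := a)) r) r)))
        = (\<Sum>a=1..N. ?p a * ?P (I(Suc t := a)) (Suc t))
          + \<eta> * (\<Sum>a=1..N. ?p a * l a (Suc t)) + (\<Sum>a=1..N. ?p a * (\<eta> * (\<Sum>r=1..t. l (I r) r)))"
      by (simp only: distrib_left sum.distrib)
        (simp add: sum_distrib_left mult.left_commute)
    also have "(\<Sum>a=1..N. ?p a * (\<eta> * (\<Sum>r=1..t. l (I r) r))) = \<eta> * (\<Sum>r=1..t. l (I r) r)"
      using sum_exp3lb_prob[OF N] by (simp flip: sum_distrib_right)
    finally show ?thesis
      using exp3lb_log_potential_step[where l = l and lb = lb and I = I and t = t, OF N \<open>\<eta> \<ge> 0\<close>]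
        Suc.prems
      by (simp del: fun_upd_apply)
  qed
  then have "?E (Suc t) (\<lambda>I. ?P I (Suc t) + \<eta> * (\<Sum>r=1..Suc t. l (I r) r))
      \<le> ?E t (\<lambda>I. ?P I t + \<eta> * (\<Sum>r=1..t. l (I r) r) + ?C (Suc t))"
    unfolding expectation_exp3lb_Suc[OF N]
    by (intro integral_mono integrable_exp3lb[OF N])
  also have "\<dots> = ?E t (\<lambda>I. ?P I t + \<eta> * (\<Sum>r=1..t. l (I r) r)) + ?C (Suc t)"
    using integrable_exp3lb[OF N]
    by (subst Bochner_Integration.integral_add) auto
  finally show ?case
    using Suc.IH Suc.prems by (simp add: distrib_left)
qed

section \<open>From the potential to the regret\<close>

lemma expectation_regret_exp3lb_le:
  assumes N: "N \<ge> 1" and "\<eta> > 0"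
    and bounds: "\<And>i t. i \<in> {1..N} \<Longrightarrow> t \<in> {1..T} \<Longrightarrow> 0 \<le> lb i t \<and> lb i t \<le> l i t \<and> l i t \<le> 1"
  shows "measure_pmf.expectation (exp3lb N \<eta> l lb T) (\<lambda>I. regret N l I T)
    \<le> ln (real N) / \<eta> + \<eta> / 2 * (\<Sum>t=1..T. 1 + (\<Sum>i=1..N. (l i t - lb i t)\<^sup>2))"
proof -
  let ?E = "measure_pmf.expectation (exp3lb N \<eta> l lb T)"
  let ?L = "\<lambda>j. \<Sum>t=1..T. l j t"
  let ?B = "\<Sum>t=1..T. 1 + (\<Sum>i=1..N. (l i t - lb i t)\<^sup>2)"
  note [simp] = integrable_exp3lb[OF N]
  \<comment> \<open>The losses are fixed in advance, so one best expert \<open>j\<close> serves for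
    all draws \<open>I\<close>, and its estimate has mean \<open>?L j\<close>.\<close>
  have "(MIN j\<in>{1..N}. ?L j) \<in> ?L ` {1..N}"
    using N by (intro Min_in) auto
  then obtain j where j: "j \<in> {1..N}" and min: "(MIN j\<in>{1..N}. ?L j) = ?L j"
    by auto
  have "\<eta> * (\<Sum>t=1..T. l (I t) t) - \<eta> * exp3lb_cum_est N \<eta> l lb I T j
      \<le> exp3lb_log_potential N \<eta> l lb I T + \<eta> * (\<Sum>t=1..T. l (I t) t)" for I
  proof -
    have "exp (- \<eta> * exp3lb_cum_est N \<eta> l lb I T j)
        \<le> (\<Sum>i=1..N. exp (- \<eta> * exp3lb_cum_est N \<eta> l lb I T i))"
      using j by (intro member_le_sum) auto
    then have "ln (exp (- \<eta> * exp3lb_cum_est N \<eta> l lb I T j)) \<le> exp3lb_log_potential N \<eta> l lb I T"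
      unfolding exp3lb_log_potential_def by (intro ln_mono) (auto intro: less_le_trans)
    then show ?thesis by simp
  qed
  then have "?E (\<lambda>I. \<eta> * (\<Sum>t=1..T. l (I t) t) - \<eta> * exp3lb_cum_est N \<eta> l lb I T j)
      \<le> ?E (\<lambda>I. exp3lb_log_potential N \<eta> l lb I T + \<eta> * (\<Sum>t=1..T. l (I t) t))"
    by (intro integral_mono) auto
  also have "\<dots> \<le> ln (real N) + \<eta>\<^sup>2 / 2 * ?B"
    using bounds \<open>\<eta> > 0\<close> by (intro expectation_exp3lb_log_potential[OF N]) auto
  finally have "\<eta> * (?E (\<lambda>I. \<Sum>t=1..T. l (I t) t) - ?L j) \<le> ln (real N) + \<eta>\<^sup>2 / 2 * ?B"
    using expectation_exp3lb_cum_est[OF j, of \<eta> l lb T]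
    by (simp add: right_diff_distrib)
  then have "?E (\<lambda>I. \<Sum>t=1..T. l (I t) t) - ?L j \<le> ln (real N) / \<eta> + \<eta> / 2 * ?B"
    using \<open>\<eta> > 0\<close> by (simp add: field_simps power2_eq_square)
  then show ?thesis
    unfolding regret_def min by simp
qed

section \<open>Observed losses and the choice of the parameter\<close>

text \<open>The gap vanishes on \<open>S t\<close>; each of the other experts contributes at most
  1.\<close>

lemma sum_observed_gap_le:
  assumes "S t \<subseteq> {1..N}" "\<And>i. i \<in> {1..N} \<Longrightarrow> l i t \<in> {0..1}"
  shows "(\<Sum>i=1..N. (l i t - observed_lb S l i t)\<^sup>2) \<le> real N - real (card (S t))"
proof -
  have "(\<Sum>i=1..N. (l i t - observed_lb S l i t)\<^sup>2)
      = (\<Sum>i\<in>{1..N} - S t. (l i t - observed_lb S l i t)\<^sup>2)"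
    by (intro sum.mono_neutral_right) (auto simp: observed_lb_def)
  also have "\<dots> \<le> (\<Sum>i\<in>{1..N} - S t. 1)"
    using assms(2) by (intro sum_mono) (auto simp: observed_lb_def power_le_one)
  also have "\<dots> = real (card ({1..N} - S t))"
    by simp
  also have "\<dots> = real N - real (card (S t))"
    using assms(1) card_mono[OF _ assms(1)] by (simp add: card_Diff_subset finite_subset)
  finally show ?thesis .
qed

theorem corollary8:
  fixes N T :: nat and l :: "nat \<Rightarrow> nat \<Rightarrow> real" and S :: "nat \<Rightarrow> nat set" and \<eta> :: real
  assumes "N \<ge> 2" and "T \<ge> 1"
    and "\<And>i t. i \<in> {1..N} \<Longrightarrow> t \<in> {1..T} \<Longrightarrow> l i t \<in> {0..1}"
    and "\<And>t. t \<in> {1..T} \<Longrightarrow> S t \<subseteq> {1..N}"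
    and "\<eta> = sqrt (8 * ln (real N) /
           (9 * real T + 4 * (\<Sum>t=1..T. real N - real (card (S t)))))"
  shows "measure_pmf.expectation (exp3lb N \<eta> l (observed_lb S l) T) (\<lambda>I. regret N l I T)
         \<le> sqrt ((9 * real T / 2 + 2 * (\<Sum>t=1..T. real N - real (card (S t)))) * ln (real N))"
proof -
  define M where "M = (\<Sum>t=1..T. real N - real (card (S t)))"
  define A where "A = 9 * real T + 4 * M"
  have "real (card (S t)) \<le> real N" if "t \<in> {1..T}" for t
    using card_mono[OF _ assms(4)[OF that]] by simp
  then have "M \<ge> 0"
    unfolding M_def by (intro sum_nonneg) auto
  then have A: "A > 0" using assms(2) by (simp add: A_def)
  have lnN: "ln (real N) > 0" using assms(1) by simp
  have eta: "\<eta> = sqrt (8 * ln (real N) / A)"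
    using assms(5) by (simp add: A_def M_def)
  then have "\<eta> > 0" using A lnN by simp
  have eta2: "\<eta>\<^sup>2 = 8 * ln (real N) / A"
    unfolding eta using A lnN by simp
  have "measure_pmf.expectation (exp3lb N \<eta> l (observed_lb S l) T) (\<lambda>I. regret N l I T)
      \<le> ln (real N) / \<eta>
        + \<eta> / 2 * (\<Sum>t=1..T. 1 + (\<Sum>i=1..N. (l i t - observed_lb S l i t)\<^sup>2))"
    using assms(1,3) \<open>\<eta> > 0\<close>
    by (intro expectation_regret_exp3lb_le) (auto simp: observed_lb_def)
  also have "\<dots> \<le> ln (real N) / \<eta> + \<eta> / 2 * (\<Sum>t=1..T. 1 + (real N - real (card (S t))))"
    using assms(3,4) \<open>\<eta> > 0\<close>
    by (intro add_left_mono mult_left_mono sum_mono sum_observed_gap_le) auto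
  also have "\<dots> = ln (real N) / \<eta> + \<eta> / 2 * (real T + M)"
    by (simp add: M_def sum.distrib)
  \<comment> \<open>Here \<open>4 * (T + M) \<le> 9 * T + 4 * M = A\<close>.\<close>
  also have "\<dots> \<le> ln (real N) / \<eta> + \<eta> * A / 8"
    using \<open>\<eta> > 0\<close> by (simp add: A_def field_simps)
  \<comment> \<open>The choice of \<open>\<eta>\<close> gives
    \<open>ln N = \<eta>\<^sup>2 * A / 8\<close>, so both summands equal
    \<open>\<eta> * A / 8\<close>.\<close>
  also have "\<dots> = \<eta> * A / 4"
    using \<open>\<eta> > 0\<close> A eta2 by (simp add: field_simps power2_eq_square)
  also have "\<dots> = sqrt ((\<eta> * A / 4)\<^sup>2)"
    using \<open>\<eta> > 0\<close> A by simp
  \<comment> \<open>Substituting \<open>\<eta>\<^sup>2\<close> leaves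
    \<open>A * ln N / 2\<close>.\<close>
  also have "(\<eta> * A / 4)\<^sup>2 = (9 * real T / 2 + 2 * M) * ln (real N)"
    unfolding power_divide power_mult_distrib eta2
    using A by (simp add: A_def field_simps power2_eq_square)
  finally show ?thesis by (simp add: M_def)
qed

end
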